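(* Let $R>1$, let $K_R=\{z\in\mathbb{C}:1/R<|z|<R\}$, and let $g$ be a univalent (injective) holomorphic function on $K_R$ that omits the value zero. Assume that, for some real $\lambda>0$, $$a_0[g]=\lambda,\qquad a_0[1/g]=-\lambda,$$ where $a_0[h]$ denotes the central (constant) Laurent coefficient in $K_R$ of a holomorphic function $h$ on $K_R$. Then $$\ln R\le \frac{\pi^2}{\ln\left(\lambda+\sqrt{1+\lambda^2}\right)}.$$
   Context: For $h$ holomorphic in the annulus $K_R=\{z:1/R<|z|<R\}$, $a_0[h]=\frac{1}{2\pi i}\int_{C_1}\frac{h(\zeta)\,d\zeta}{\zeta}$, where $C_1=\{z\in\mathbb{C}:|z|=1\}$ is positively oriented. *)

theory Defs
  imports "HOL-Complex_Analysis.Complex_Analysis"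
begin

definition sym_annulus :: "real \<Rightarrow> complex set" where
  "sym_annulus R = {z. 1 / R < norm z \<and> norm z < R}"

(* Meaningful for h holomorphic on an annulus around the unit circle; in particular, h must be
   integrable over the circle. *)
definition central_coeff :: "(complex \<Rightarrow> complex) \<Rightarrow> complex" where
  "central_coeff h =
     1 / (2 * of_real pi * \<i>) * contour_integral (circlepath 0 1) (\<lambda>z. h z / z)"

end

theory Submission
  imports Defs
begin

text \<open>
  Put \<open>p = \<lambda> + sqrt (1 + \<lambda>\<^sup>2)\<close>, so that \<open>\<lambda> = (p - 1/p)/2\<close>. On every circle \<open>|z| = r\<close> the mean values of
  \<open>g\<close> and \<open>-1/g\<close> are \<open>\<lambda>\<close>, so \<open>g\<close> takes there a value in the half-plane \<open>Re w \<ge> \<lambda>\<close> and a value in the disc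
  \<open>Re (-1/w) \<ge> \<lambda>\<close>. Both regions are bounded by level circles of \<open>T w = (w + 1/p)/(w - p)\<close>, namely
  \<open>|T| = 1\<close> and \<open>|T| = 1/p\<^sup>2\<close>; hence the image of every circle crosses the ring \<open>1/p\<^sup>2 < |T| < 1\<close>.
  In the metric \<open>|dT|/|T|\<close> the crossing has length at least \<open>2 ln p\<close>, whereas the ring has area
  \<open>4 \<pi> ln p\<close>. Since \<open>g\<close> is injective, the length-area inequality gives the bound.
\<close>

subsection \<open>Change of variables under injective holomorphic maps\<close>

text \<open>\<open>Complex\<close> pulls boxes back to boxes of equal area, and Lebesgue measure is
  determined by its values on boxes. Pair coordinates give access to Fubini's theorem.\<close>

lemma lborel_distr_Complex:
  "distr lborel lborel (\<lambda>(x, y). Complex x y) = (lborel :: complex measure)"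
proof (rule lborel_eqI[symmetric])
  let ?c = "\<lambda>(x, y). Complex x y"
  fix l u :: complex
  assume "\<And>b. b \<in> Basis \<Longrightarrow> l \<bullet> b \<le> u \<bullet> b"
  from this[of 1] this[of \<i>] have le: "Re l \<le> Re u" "Im l \<le> Im u"
    by (simp_all add: Basis_complex_def)
  have eq: "?c -` box l u = box (Re l, Im l) (Re u, Im u)"
    by (auto simp: box_def Basis_complex_def Basis_prod_def)
  have [measurable]: "?c \<in> borel \<rightarrow>\<^sub>M borel"
    by (intro borel_measurable_continuous_onI)
      (auto simp: case_prod_unfold Complex_eq intro!: continuous_intros)
  have "emeasure (distr lborel lborel ?c) (box l u) = emeasure lborel (box (Re l, Im l) (Re u, Im u))"
    by (subst emeasure_distr) (auto simp: eq)
  also have "\<dots> = (\<Prod>b\<in>Basis. (u - l) \<bullet> b)"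
    using le by (subst emeasure_lborel_box)
      (auto simp: Basis_complex_def Basis_prod_def prod.union_disjoint algebra_simps)
  finally show "emeasure (distr lborel lborel ?c) (box l u) = (\<Prod>b\<in>Basis. (u - l) \<bullet> b)" .
qed simp

text \<open>The plane as \<open>real^2\<close>, the form in which a change of variables with
  Jacobian \<open>det (matrix _)\<close> applies.\<close>

definition complex_of_vec :: "real^2 \<Rightarrow> complex" where
  "complex_of_vec v = Complex (v $ 1) (v $ 2)"

definition vec_of_complex :: "complex \<Rightarrow> real^2" where
  "vec_of_complex z = vector [Re z, Im z]"

lemma complex_of_vec_of_complex [simp]: "complex_of_vec (vec_of_complex z) = z"
  by (simp add: complex_of_vec_def vec_of_complex_def)

lemma vec_of_complex_of_vec [simp]: "vec_of_complex (complex_of_vec v) = v"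
  by (simp add: complex_of_vec_def vec_of_complex_def vec_eq_iff forall_2)

lemma linear_complex_of_vec: "linear complex_of_vec"
  by (auto intro!: linearI simp: complex_of_vec_def complex_eq_iff)

lemma linear_vec_of_complex: "linear vec_of_complex"
  by (auto intro!: linearI simp: vec_of_complex_def vec_eq_iff forall_2)

lemma borel_measurable_complex_of_vec [measurable]: "complex_of_vec \<in> borel \<rightarrow>\<^sub>M borel"
  using linear_complex_of_vec
  by (intro borel_measurable_continuous_onI linear_continuous_on) (simp add: linear_conv_bounded_linear)

lemma lborel_distr_complex_of_vec: "distr lborel lborel complex_of_vec = lborel"
proof (rule lborel_eqI[symmetric])
  fix l u :: complex
  assume "\<And>b. b \<in> Basis \<Longrightarrow> l \<bullet> b \<le> u \<bullet> b"
  from this[of 1] this[of \<i>] have le: "Re l \<le> Re u" "Im l \<le> Im u"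
    by (simp_all add: Basis_complex_def)
  have eq: "complex_of_vec -` box l u = box (vec_of_complex l) (vec_of_complex u)"
    by (auto simp: box_def Basis_complex_def Basis_vec_def inner_axis forall_2
        complex_of_vec_def vec_of_complex_def)
  have B: "(Basis :: (real^2) set) = {axis 1 1, axis 2 1}"
    by (auto simp: Basis_vec_def) (metis exhaust_2)
  have ne: "axis 1 1 \<noteq> (axis 2 1 :: real^2)" by (simp add: axis_eq_axis)
  have "emeasure (distr lborel lborel complex_of_vec) (box l u)
      = emeasure lborel (box (vec_of_complex l) (vec_of_complex u))"
    by (subst emeasure_distr) (auto simp: eq)
  also have "\<dots> = (\<Prod>b\<in>Basis. (u - l) \<bullet> b)"
    using le ne by (subst emeasure_lborel_box)
      (auto simp: Basis_complex_def B inner_axis vec_of_complex_def)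
  finally show "emeasure (distr lborel lborel complex_of_vec) (box l u) = (\<Prod>b\<in>Basis. (u - l) \<bullet> b)" .
qed simp

lemma nn_integral_complex_eq_vec:
  assumes "f \<in> borel_measurable borel"
  shows "(\<integral>\<^sup>+z. f z \<partial>lborel) = (\<integral>\<^sup>+v. f (complex_of_vec v) \<partial>lborel)"
  using assms by (subst lborel_distr_complex_of_vec[symmetric], subst nn_integral_distr) auto

lemma nn_integral_complex_eq_iterated:
  assumes [measurable]: "f \<in> borel_measurable borel"
  shows "(\<integral>\<^sup>+z. f z \<partial>lborel) = (\<integral>\<^sup>+x. \<integral>\<^sup>+y. f (Complex x y) \<partial>lborel \<partial>lborel)"
proof -
  let ?c = "\<lambda>(x, y). Complex x y"
  have [measurable]: "?c \<in> borel \<rightarrow>\<^sub>M borel"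
    by (intro borel_measurable_continuous_onI)
      (auto simp: case_prod_unfold Complex_eq intro!: continuous_intros)
  have "(\<integral>\<^sup>+z. f z \<partial>lborel) = (\<integral>\<^sup>+v. f (?c v) \<partial>lborel)"
    by (subst lborel_distr_Complex[symmetric], subst nn_integral_distr) auto
  also have "\<dots> = (\<integral>\<^sup>+x. \<integral>\<^sup>+y. f (?c (x, y)) \<partial>lborel \<partial>lborel)"
  proof -
    have "(\<lambda>v. f (?c v)) \<in> borel_measurable (borel :: (real \<times> real) measure)" by measurable
    then show ?thesis
      by (subst lborel_prod[symmetric], subst lborel.nn_integral_fst[symmetric])
        (simp_all add: lborel_prod)
  qed
  finally show ?thesis by simp
qed

text \<open>Nonnegative integrands are integrable exactly when absolutely integrable, so the theorem
  on absolute integrals carries over. A finite value on either side is attained on the other, hence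
  the two sides are also infinite together, and no finiteness has to be known in advance.\<close>

lemma nn_integral_change_of_variables_vec:
  fixes f :: "real^'n::{finite,wellorder} \<Rightarrow> real^'n::_" and h :: "real^'n::_ \<Rightarrow> real"
  assumes S: "S \<in> sets borel" and fS: "f ` S \<in> sets borel"
    and der: "\<And>x. x \<in> S \<Longrightarrow> (f has_derivative f' x) (at x within S)"
    and inj: "inj_on f S"
    and nn: "\<And>y. y \<in> f ` S \<Longrightarrow> 0 \<le> h y"
    and mh: "(\<lambda>y. indicator (f ` S) y * h y) \<in> borel_measurable borel"
    and mf: "(\<lambda>x. indicator S x * (\<bar>det (matrix (f' x))\<bar> * h (f x))) \<in> borel_measurable borel"
  shows "(\<integral>\<^sup>+x\<in>S. \<bar>det (matrix (f' x))\<bar> * h (f x) \<partial>lborel) = (\<integral>\<^sup>+y\<in>f ` S. h y \<partial>lborel)"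
proof -
  let ?D = "\<lambda>x. \<bar>det (matrix (f' x))\<bar> * h (f x)"
  \<comment> \<open>The underlying theorem concerns vector-valued integrands, so the real function
    is wrapped into \<open>real^1\<close>.\<close>
  have iff: "(?D has_integral b) S \<longleftrightarrow> (h has_integral b) (f ` S)" for b
  proof -
    have "?D absolutely_integrable_on S \<and> integral S ?D = b \<longleftrightarrow>
        h absolutely_integrable_on (f ` S) \<and> integral (f ` S) h = b"
      using has_absolute_integral_change_of_variables [OF _ der inj, of "\<lambda>x. vec (h x) :: real^1" "vec b"] S
      unfolding absolutely_integrable_on_1_iff integral_on_1_eq
      by simp
    moreover have "?D absolutely_integrable_on S \<longleftrightarrow> ?D integrable_on S"
      using nn by (intro absolutely_integrable_on_iff_nonneg) auto
    moreover have "h absolutely_integrable_on (f ` S) \<longleftrightarrow> h integrable_on (f ` S)"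
      using nn by (intro absolutely_integrable_on_iff_nonneg) auto
    ultimately show ?thesis by (auto simp: has_integral_iff)
  qed
  have ex: "\<exists>b. (k has_integral b) A \<and> 0 \<le> b"
    if "(\<lambda>x. indicator A x * k x) \<in> borel_measurable borel" "\<And>x. x \<in> A \<Longrightarrow> 0 \<le> k x"
      and fin: "(\<integral>\<^sup>+x\<in>A. ennreal (k x) \<partial>lborel) < \<infinity>"
    for k :: "real^'n::_ \<Rightarrow> real" and A
  proof -
    obtain b where b: "0 \<le> b" "(\<integral>\<^sup>+x\<in>A. ennreal (k x) \<partial>lborel) = ennreal b"
      using fin by (cases "(\<integral>\<^sup>+x\<in>A. ennreal (k x) \<partial>lborel)") auto
    have "(\<integral>\<^sup>+x. ennreal (indicator A x * k x) \<partial>lborel) = ennreal b"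
      unfolding b(2)[symmetric] by (intro nn_integral_cong) (auto simp: indicator_def)
    then have "((\<lambda>x. indicator A x * k x) has_integral b) UNIV"
      using that b by (intro nn_integral_has_integral) (auto simp: indicator_def)
    moreover have "(\<lambda>x. indicator A x * k x) = (\<lambda>x. if x \<in> A then k x else 0)" by auto
    ultimately show ?thesis using b(1) by (auto simp: has_integral_restrict_UNIV)
  qed
  have to_nn: "(\<integral>\<^sup>+x\<in>S. ?D x \<partial>lborel) = b \<and> (\<integral>\<^sup>+y\<in>f ` S. h y \<partial>lborel) = b"
    if "(?D has_integral b) S" for b
    using that iff nn_integral_has_integral_lebesgue'[of S ?D b]
      nn_integral_has_integral_lebesgue'[of "f ` S" h b] nn by auto
  show ?thesis
  proof (cases "(\<integral>\<^sup>+x\<in>S. ?D x \<partial>lborel) < \<infinity>")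
    case True
    then show ?thesis using ex[OF mf] to_nn nn by fastforce
  next
    case False
    moreover have "\<not> (\<integral>\<^sup>+y\<in>f ` S. h y \<partial>lborel) < \<infinity>"
    proof
      assume "(\<integral>\<^sup>+y\<in>f ` S. h y \<partial>lborel) < \<infinity>"
      then obtain b where "(h has_integral b) (f ` S)" using ex[OF mh] nn by blast
      then have "(?D has_integral b) S" using iff by blast
      from to_nn[OF this] False show False by simp
    qed
    ultimately show ?thesis by (simp add: not_less top_unique)
  qed
qed

lemma borel_measurable_ennreal_indicator:
  fixes f :: "'a::topological_space \<Rightarrow> real"
  assumes "open S" "continuous_on S f"
  shows "(\<lambda>x. ennreal (f x) * indicator S x) \<in> borel_measurable borel"
proof -
  have "(\<lambda>x. ennreal (indicator S x *\<^sub>R f x)) \<in> borel_measurable borel"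
    using assms by (intro measurable_compose[OF borel_measurable_continuous_on_indicator]) auto
  also have "(\<lambda>x. ennreal (indicator S x *\<^sub>R f x)) = (\<lambda>x. ennreal (f x) * indicator S x)"
    by (auto simp: indicator_def)
  finally show ?thesis .
qed

text \<open>The real differential of a holomorphic map is multiplication by
  \<open>deriv f z\<close>, whose Jacobian is the squared modulus. The image is open by the open
  mapping theorem, so continuity of \<open>h\<close> there settles measurability.\<close>

lemma nn_integral_holomorphic_change_of_variables:
  fixes f :: "complex \<Rightarrow> complex" and h :: "complex \<Rightarrow> real"
  assumes "open S" and holo: "f holomorphic_on S" and inj: "inj_on f S"
    and conth: "continuous_on (f ` S) h" and nn: "\<And>y. y \<in> f ` S \<Longrightarrow> 0 \<le> h y"
  shows "(\<integral>\<^sup>+z\<in>S. (cmod (deriv f z))\<^sup>2 * h (f z) \<partial>lborel) = (\<integral>\<^sup>+w\<in>f ` S. h w \<partial>lborel)"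
proof -
  have ofS: "open (f ` S)" using open_mapping_thm3[OF holo \<open>open S\<close> inj] .
  define c where "c = complex_of_vec"
  define d where "d = vec_of_complex"
  have [simp]: "c (d z) = z" "d (c v) = v" for z v by (simp_all add: c_def d_def)
  have blc: "bounded_linear c" and bld: "bounded_linear d"
    unfolding c_def d_def using linear_complex_of_vec linear_vec_of_complex
    by (simp_all add: linear_conv_bounded_linear)
  have contc: "continuous_on A c" for A using blc linear_continuous_on by blast
  define S' where "S' = c -` S"
  have "open S'" unfolding S'_def using \<open>open S\<close> contc by (simp add: open_vimage)
  define k where "k = (\<lambda>v. d (f (c v)))"
  define k' where "k' = (\<lambda>v u. d (deriv f (c v) * c u))"
  have im: "k ` S' = c -` (f ` S)"
  proof safe
    fix v assume "v \<in> S'" then show "k v \<in> c -` (f ` S)" by (auto simp: k_def S'_def)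
  next
    fix v z assume "c v = f z" "z \<in> S"
    then have "v = k (d z)" "d z \<in> S'" by (metis \<open>\<And>v. d (c v) = v\<close> \<open>\<And>z. c (d z) = z\<close> k_def)
      (simp add: \<open>z \<in> S\<close> S'_def)
    then show "v \<in> k ` S'" by blast
  qed
  have "open (k ` S')" unfolding im using ofS contc by (simp add: open_vimage)
  have der: "(k has_derivative k' v) (at v within S')" if "v \<in> S'" for v
  proof -
    have "(f has_field_derivative deriv f (c v)) (at (c v))"
      using holo \<open>open S\<close> that by (auto simp: S'_def intro: holomorphic_derivI)
    then have "(f has_derivative (\<lambda>u. deriv f (c v) * u)) (at (c v))"
      by (simp add: has_field_derivative_def)
    from has_derivative_compose[OF bounded_linear_imp_has_derivative[OF blc] this]
    have "((\<lambda>v. f (c v)) has_derivative (\<lambda>u. deriv f (c v) * c u)) (at v)" by simp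
    from has_derivative_compose[OF this bounded_linear_imp_has_derivative[OF bld]]
    show ?thesis unfolding k_def k'_def by (rule has_derivative_at_withinI)
  qed
  \<comment> \<open>Multiplication by \<open>a + b * \<i>\<close> has the real matrix with rows
    \<open>(a, -b)\<close> and \<open>(b, a)\<close>, of determinant
    \<open>a^2 + b^2\<close>.\<close>
  have det: "det (matrix (k' v)) = (cmod (deriv f (c v)))\<^sup>2" for v
    unfolding cmod_power2
    by (simp add: det_2 matrix_def k'_def d_def c_def vec_of_complex_def complex_of_vec_def
        axis_def power2_eq_square)
  have injk: "inj_on k S'"
    using inj unfolding inj_on_def k_def S'_def
    by (metis \<open>\<And>v. d (c v) = v\<close> \<open>\<And>z. c (d z) = z\<close> vimageE)
  have cf: "continuous_on S (\<lambda>z. (cmod (deriv f z))\<^sup>2 * h (f z))"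
    using holo conth \<open>open S\<close>
    by (auto intro!: continuous_intros holomorphic_on_imp_continuous_on holomorphic_deriv
        continuous_on_compose2[OF conth])
  have ck: "c (k v) = f (c v)" for v by (simp add: k_def)
  have cfk: "continuous_on S' (\<lambda>v. \<bar>det (matrix (k' v))\<bar> * h (c (k v)))"
    using continuous_on_compose2[OF cf contc, of S'] by (auto simp: det k_def S'_def)
  have chk: "continuous_on (k ` S') (\<lambda>v. h (c v))"
    using continuous_on_compose2[OF conth contc, of "k ` S'"] by (auto simp: im)
  have "(\<integral>\<^sup>+z\<in>S. (cmod (deriv f z))\<^sup>2 * h (f z) \<partial>lborel)
      = (\<integral>\<^sup>+v\<in>S'. \<bar>det (matrix (k' v))\<bar> * h (c (k v)) \<partial>lborel)"
    using borel_measurable_ennreal_indicator[OF \<open>open S\<close> cf]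
    by (subst nn_integral_complex_eq_vec) (simp_all add: det ck S'_def indicator_def flip: c_def)
  also have "\<dots> = (\<integral>\<^sup>+v\<in>k ` S'. h (c v) \<partial>lborel)"
  proof (rule nn_integral_change_of_variables_vec[OF _ _ der injk])
    show "S' \<in> sets borel" "k ` S' \<in> sets borel"
      using \<open>open S'\<close> \<open>open (k ` S')\<close> by auto
    show "0 \<le> h (c y)" if "y \<in> k ` S'" for y using that nn im by auto
    show "(\<lambda>y. indicator (k ` S') y * h (c y)) \<in> borel_measurable borel"
      using borel_measurable_continuous_on_indicator[OF _ chk] \<open>open (k ` S')\<close> by simp
    show "(\<lambda>x. indicator S' x * (\<bar>det (matrix (k' x))\<bar> * h (c (k x)))) \<in> borel_measurable borel"
      using borel_measurable_continuous_on_indicator[OF _ cfk] \<open>open S'\<close> by simp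
  qed
  also have "\<dots> = (\<integral>\<^sup>+w\<in>f ` S. h w \<partial>lborel)"
    using borel_measurable_ennreal_indicator[OF ofS conth]
    by (subst nn_integral_complex_eq_vec) (auto simp: im c_def indicator_def)
  finally show ?thesis .
qed

subsection \<open>Mean values on circles\<close>

text \<open>The unit circle deforms inside the annulus into the circle of radius \<open>r\<close>,
  so by Cauchy's theorem the coefficient is the mean of \<open>h\<close> over every such
  circle.\<close>

lemma has_integral_central_coeff:
  assumes "R > 1" and holo: "h holomorphic_on sym_annulus R" and r: "1 / R < r" "r < R"
  shows "((\<lambda>t. h (of_real r * cis t)) has_integral 2 * of_real pi * central_coeff h) {0..2 * pi}"
proof -
  have "0 < r" using r \<open>R > 1\<close> by (meson less_trans zero_less_divide_1_iff zero_less_one)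
  have "open (sym_annulus R)"
    unfolding sym_annulus_def by (intro open_Collect_conj open_Collect_less continuous_intros)
  have 0: "z \<noteq> 0" if "z \<in> sym_annulus R" for z
    using that \<open>R > 1\<close> by (auto simp: sym_annulus_def)
  have hq: "(\<lambda>z. h z / z) holomorphic_on sym_annulus R"
    using holo 0 by (auto intro!: holomorphic_intros)
  have "homotopic_loops (sym_annulus R) (circlepath 0 1) (circlepath 0 r)"
  proof (rule homotopic_loops_linear)
    fix t :: real
    show "closed_segment (circlepath 0 1 t) (circlepath 0 r t) \<subseteq> sym_annulus R"
    proof
      fix z assume "z \<in> closed_segment (circlepath 0 1 t) (circlepath 0 r t)"
      then obtain u where u: "0 \<le> u" "u \<le> 1"
        and z: "z = (1 - u) *\<^sub>R circlepath 0 1 t + u *\<^sub>R circlepath 0 r t"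
        by (auto simp: in_segment)
      \<comment> \<open>Both circles are at the same angle at time \<open>t\<close>, so the segment
        is radial and its moduli lie between 1 and \<open>r\<close>.\<close>
      have "z = of_real ((1 - u) * 1 + u * r) * exp (2 * of_real pi * \<i> * of_real t)"
        unfolding z circlepath by (simp add: algebra_simps scaleR_conv_of_real)
      then have nz: "norm z = (1 - u) * 1 + u * r"
        using u \<open>0 < r\<close> by (simp only: norm_mult norm_of_real) (simp add: norm_exp_eq_Re)
      have "1 / R < 1" using \<open>R > 1\<close> by simp
      have "(1 - u) * 1 + u * r \<in> closed_segment 1 r"
        using u by (auto simp: in_segment)
      moreover have "closed_segment 1 r \<subseteq> {1 / R<..<R}"
        using r \<open>R > 1\<close> by (intro closed_segment_subset) auto
      ultimately show "z \<in> sym_annulus R" using nz by (auto simp: sym_annulus_def)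
    qed
  qed auto
  then have eq: "contour_integral (circlepath 0 1) (\<lambda>z. h z / z) = contour_integral (circlepath 0 r) (\<lambda>z. h z / z)"
    using \<open>open (sym_annulus R)\<close> hq by (rule Cauchy_theorem_homotopic_loops) auto
  have "(\<lambda>z. h z / z) contour_integrable_on circlepath 0 r"
    using \<open>0 < r\<close> r hq
    by (intro contour_integrable_holomorphic_simple[OF _ \<open>open (sym_annulus R)\<close>]) (auto simp: sym_annulus_def)
  then have "((\<lambda>z. h z / z) has_contour_integral 2 * of_real pi * \<i> * central_coeff h) (circlepath 0 r)"
    using has_contour_integral_integral eq by (fastforce simp: central_coeff_def)
  \<comment> \<open>On the circle \<open>dz / z = \<i> dt\<close>; the factor \<open>\<i>\<close> is
    removed afterwards by multiplying with \<open>- \<i>\<close>.\<close>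
  then have "((\<lambda>t. \<i> * h (of_real r * cis t)) has_integral 2 * of_real pi * \<i> * central_coeff h) {0..2 * pi}"
    using \<open>0 < r\<close> unfolding circlepath_def by (simp add: has_contour_integral_part_circlepath_iff mult.commute)
  from has_integral_mult_right[OF this, of "- \<i>"] show ?thesis
    by (simp add: algebra_simps)
qed

text \<open>A non-integrable integrand and its negative both receive the default integral 0, so the
  sign can be pulled out for every \<open>h\<close>.\<close>

lemma central_coeff_minus: "central_coeff (\<lambda>z. - h z) = - central_coeff h"
  unfolding central_coeff_def contour_integral_integral minus_divide_left[symmetric] mult_minus_left integral_neg
  by simp

text \<open>If \<open>f\<close> stayed below its mean \<open>c\<close>, then \<open>c - f\<close>
  would be continuous and positive with integral 0, which forces it to vanish at
  \<open>a\<close>.\<close>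

lemma ex_ge_mean:
  fixes f :: "real \<Rightarrow> real"
  assumes "a < b" "continuous_on {a..b} f" "(f has_integral (b - a) * c) {a..b}"
  shows "\<exists>t\<in>{a..b}. c \<le> f t"
proof (rule ccontr)
  assume "\<not> ?thesis"
  then have lt: "f t < c" if "t \<in> {a..b}" for t using that by (meson not_le)
  have "((\<lambda>t. c - f t) has_integral (b - a) * c - (b - a) * c) {a..b}"
    using has_integral_const_real[of c a b] \<open>a < b\<close> by (intro has_integral_diff assms) simp
  then have int: "((\<lambda>t. c - f t) has_integral 0) (cbox a b)" by simp
  have "c - f a = 0"
  proof (rule has_integral_0_cbox_imp_0[OF _ _ int])
    show "continuous_on (cbox a b) (\<lambda>t. c - f t)" using assms by (auto intro!: continuous_intros)
    show "0 \<le> c - f t" if "t \<in> box a b" for t using lt[of t] that by auto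
  qed (use \<open>a < b\<close> in auto)
  then show False using lt[of a] \<open>a < b\<close> by simp
qed

lemma ex_Re_ge_central_coeff:
  assumes "R > 1" and holo: "h holomorphic_on sym_annulus R" and r: "1 / R < r" "r < R"
  shows "\<exists>t\<in>{0..2*pi}. Re (central_coeff h) \<le> Re (h (of_real r * cis t))"
proof (rule ex_ge_mean)
  have "0 < r" using r \<open>R > 1\<close> by (meson less_trans zero_less_divide_1_iff zero_less_one)
  show "continuous_on {0..2 * pi} (\<lambda>t. Re (h (of_real r * cis t)))"
    using r \<open>0 < r\<close> by (auto intro!: continuous_intros continuous_on_compose2[OF holomorphic_on_imp_continuous_on[OF holo]]
      simp: sym_annulus_def norm_mult)
  show "((\<lambda>t. Re (h (of_real r * cis t))) has_integral (2 * pi - 0) * Re (central_coeff h)) {0..2 * pi}"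
    using has_integral_Re[OF has_integral_central_coeff[OF assms]] by simp
qed simp

subsection \<open>The length-area inequality\<close>

text \<open>Going from the low point to the high one, \<open>b\<close> is the first time the level
  \<beta> is hit and \<open>a\<close> the last time before \<open>b\<close> at the level \<alpha>.
  The set equation for the end values leaves the direction of the crossing open, since
  \<open>x\<close> may lie on either side of \<open>y\<close>.\<close>

lemma continuous_crossing_interval:
  fixes f :: "real \<Rightarrow> real"
  assumes cont: "continuous_on {l..u} f" and ab: "\<alpha> < \<beta>"
    and x: "x \<in> {l..u}" "f x \<le> \<alpha>" and y: "y \<in> {l..u}" "\<beta> \<le> f y"
  obtains a b where "l \<le> a" "a < b" "b \<le> u" "{f a, f b} = {\<alpha>, \<beta>}"
    "\<And>t. t \<in> {a<..<b} \<Longrightarrow> \<alpha> < f t \<and> f t < \<beta>"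
proof -
  have up: "\<exists>a b. x \<le> a \<and> a < b \<and> b \<le> y \<and> f a = \<alpha> \<and> f b = \<beta> \<and> (\<forall>t\<in>{a<..<b}. \<alpha> < f t \<and> f t < \<beta>)"
    if cont: "continuous_on {x..y} f" and ab: "\<alpha> < \<beta>" and fx: "f x \<le> \<alpha>" and fy: "\<beta> \<le> f y" and "x \<le> y"
    for f :: "real \<Rightarrow> real" and \<alpha> \<beta> x y
  proof -
    have comp: "compact ({x..u} \<inter> f -` {v})" if "u \<le> y" for u v
      using that cont
      by (auto simp: compact_eq_bounded_closed intro!: bounded_Int continuous_closed_preimage
          intro: continuous_on_subset)
    have "{x..y} \<inter> f -` {\<beta>} \<noteq> {}"
      using IVT'[of f x \<beta> y] ab fx fy \<open>x \<le> y\<close> cont by auto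
    from compact_attains_inf[OF comp[OF order_refl] this]
    obtain b where b: "b \<in> {x..y}" "f b = \<beta>"
      and b_min: "\<And>t. t \<in> {x..y} \<Longrightarrow> f t = \<beta> \<Longrightarrow> b \<le> t"
      by auto
    have cont': "continuous_on {s..t} f" if "x \<le> s" "t \<le> y" for s t
      using that by (intro continuous_on_subset[OF cont]) auto
    have "{x..b} \<inter> f -` {\<alpha>} \<noteq> {}"
      using IVT'[of f x \<alpha> b] ab fx b cont'[of x b] by auto
    from compact_attains_sup[OF comp this]
    obtain a where a: "a \<in> {x..b}" "f a = \<alpha>"
      and a_max: "\<And>t. t \<in> {x..b} \<Longrightarrow> f t = \<alpha> \<Longrightarrow> t \<le> a"
      using b by auto
    have "f t < \<beta>" if tab: "t \<in> {a<..<b}" for t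
    proof (rule ccontr)
      assume "\<not> f t < \<beta>"
      then obtain s where "a \<le> s" "s \<le> t" "f s = \<beta>"
        using IVT'[of f a \<beta> t] tab a b \<open>\<alpha> < \<beta>\<close> cont'[of a t] by auto
      then show False using b_min[of s] tab a b by auto
    qed
    moreover have "\<alpha> < f t" if tab: "t \<in> {a<..<b}" for t
    proof (rule ccontr)
      assume "\<not> \<alpha> < f t"
      then obtain s where "t \<le> s" "s \<le> b" "f s = \<alpha>"
        using IVT'[of f t \<alpha> b] tab a b \<open>\<alpha> < \<beta>\<close> cont'[of t b] by auto
      then show False using a_max[of s] tab a b by auto
    qed
    moreover have "a \<noteq> b" using a b \<open>\<alpha> < \<beta>\<close> by auto
    ultimately show ?thesis using a b by (intro exI[of _ a] exI[of _ b]) auto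
  qed
  show ?thesis
  proof (cases "x \<le> y")
    case True
    have "continuous_on {x..y} f" using x y by (intro continuous_on_subset[OF cont]) auto
    from up[OF this ab x(2) y(2) True] show ?thesis using x y that by (metis (no_types, lifting) atLeastAtMost_iff order_trans)
  next
    case False
    \<comment> \<open>For a descending crossing, \<open>- f\<close> ascends from at most
      \<open>- \<beta>\<close> to at least \<open>- \<alpha>\<close>.\<close>
    have "continuous_on {y..x} (\<lambda>t. - f t)"
      using x y by (intro continuous_on_minus continuous_on_subset[OF cont]) auto
    from up[OF this, of "- \<beta>" "- \<alpha>"] False ab x(2) y(2)
    obtain a b where "y \<le> a" "a < b" "b \<le> x" "f a = \<beta>" "f b = \<alpha>"
      "\<forall>t\<in>{a<..<b}. \<alpha> < f t \<and> f t < \<beta>" by auto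
    then show ?thesis using x y by (intro that[of a b]) auto
  qed
qed

text \<open>Locally \<open>ln (cmod (f t))\<close> is the real part of a logarithm of
  \<open>f\<close>. Working with real and imaginary parts avoids choosing a branch.\<close>

lemma has_real_derivative_ln_norm:
  fixes f :: "real \<Rightarrow> complex"
  assumes "(f has_vector_derivative D) (at t within S)" and "f t \<noteq> 0"
  shows "((\<lambda>t. ln (cmod (f t))) has_real_derivative Re (D / f t)) (at t within S)"
proof -
  have "(f has_derivative (\<lambda>x. x *\<^sub>R D)) (at t within S)"
    using assms by (simp add: has_vector_derivative_def)
  from has_derivative_Re[OF this] has_derivative_Im[OF this]
  have Re: "((\<lambda>t. Re (f t)) has_real_derivative Re D) (at t within S)"
    and Im: "((\<lambda>t. Im (f t)) has_real_derivative Im D) (at t within S)"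
    by (simp_all add: has_field_derivative_def mult_commute_abs)
  have pos: "(Re (f t))\<^sup>2 + (Im (f t))\<^sup>2 > 0"
    using assms(2) by (metis cmod_power2 norm_eq_zero zero_less_power2)
  have eq: "ln (cmod z) = ln ((Re z)\<^sup>2 + (Im z)\<^sup>2) / 2" for z
    by (metis cmod_def ln_sqrt not_sum_power2_lt_zero not_le_imp_less ln_sqrt)
  have "((\<lambda>t. ln ((u t)\<^sup>2 + (v t)\<^sup>2) / 2) has_real_derivative (u t * u' + v t * v') / ((u t)\<^sup>2 + (v t)\<^sup>2))
      (at t within S)"
    if u: "(u has_real_derivative u') (at t within S)" and v: "(v has_real_derivative v') (at t within S)"
      and pos: "(u t)\<^sup>2 + (v t)\<^sup>2 > 0" for u v :: "real \<Rightarrow> real" and u' v'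
  proof -
    define N where "N = u t * u' + v t * v'"
    have "((\<lambda>t. (u t)\<^sup>2 + (v t)\<^sup>2) has_real_derivative 2 * N) (at t within S)"
      using u v by (auto intro!: derivative_eq_intros simp: N_def algebra_simps)
    from DERIV_cdivide[OF DERIV_chain2[OF DERIV_ln_divide[OF pos] this], of 2]
    show ?thesis by (rule DERIV_cong) (use pos in \<open>simp add: divide_simps flip: N_def\<close>)
  qed
  from this[OF Re Im pos] show ?thesis
    unfolding eq by (simp add: Re_divide algebra_simps)
qed

text \<open>Pointwise, AM-GM gives \<open>\<bar>f'/f\<bar> \<le> K \<bar>f'/f\<bar>\<^sup>2 + 1/(4K)\<close>; optimising over \<open>K\<close> is Cauchy-Schwarz.\<close>
lemma log_variation_le:
  fixes f :: "real \<Rightarrow> complex"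
  assumes "a \<le> b" "K > 0"
    and der: "\<And>t. t \<in> {a..b} \<Longrightarrow> (f has_vector_derivative f' t) (at t within {a..b})"
    and cont: "continuous_on {a..b} f'" and nz: "\<And>t. t \<in> {a..b} \<Longrightarrow> f t \<noteq> 0"
  shows "\<bar>ln (cmod (f b)) - ln (cmod (f a))\<bar>
    \<le> K * integral {a..b} (\<lambda>t. (cmod (f' t))\<^sup>2 * (1 / (cmod (f t))\<^sup>2)) + (b - a) / (4 * K)"
proof -
  let ?q = "\<lambda>t. (cmod (f' t))\<^sup>2 * (1 / (cmod (f t))\<^sup>2)"
  have "continuous_on {a..b} f"
    using der by (meson continuous_on_vector_derivative)
  then have "?q integrable_on {a..b}"
    using cont nz by (intro integrable_continuous_real continuous_intros) auto
  then have I: "((\<lambda>t. K * ?q t + 1 / (4 * K)) has_integral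
      K * integral {a..b} ?q + (b - a) / (4 * K)) {a..b}"
    using has_integral_const_real[of "1 / (4 * K)" a b] \<open>a \<le> b\<close>
    by (intro has_integral_add has_integral_mult_right) (auto intro: integrable_integral)
  have J: "((\<lambda>t. Re (f' t / f t)) has_integral (ln (cmod (f b)) - ln (cmod (f a)))) {a..b}"
    using has_real_derivative_ln_norm[OF der nz] \<open>a \<le> b\<close>
    by (intro fundamental_theorem_of_calculus) (auto simp: has_real_derivative_iff_has_vector_derivative)
  have bd: "\<bar>Re (f' t / f t)\<bar> \<le> K * ?q t + 1 / (4 * K)" for t
  proof -
    define s where "s = cmod (f' t / f t)"
    have "\<bar>Re (f' t / f t)\<bar> \<le> s" unfolding s_def by (rule abs_Re_le_cmod)
    also have "0 \<le> (2 * K * s - 1)\<^sup>2 / (4 * K)" using \<open>K > 0\<close> by simp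
    then have "s \<le> K * s\<^sup>2 + 1 / (4 * K)"
      using \<open>K > 0\<close> by (simp add: field_simps power2_eq_square)
    finally show ?thesis by (simp add: s_def norm_divide power_divide)
  qed
  have "ln (cmod (f b)) - ln (cmod (f a)) \<le> K * integral {a..b} ?q + (b - a) / (4 * K)"
    by (rule has_integral_le[OF J I]) (use bd in \<open>auto simp: abs_le_iff\<close>)
  moreover have "- (ln (cmod (f b)) - ln (cmod (f a))) \<le> K * integral {a..b} ?q + (b - a) / (4 * K)"
    by (rule has_integral_le[OF has_integral_neg[OF J] I]) (use bd in \<open>auto simp: abs_le_iff\<close>)
  ultimately show ?thesis by linarith
qed

text \<open>This is the ring's area in the metric \<open>|dw| / |w|\<close>. The exponential map
  pulls that metric back to the Euclidean one, so the ring slit along the negative axis has the area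
  of a rectangle with sides \<open>ln b - ln a\<close> and \<open>2 * pi\<close>.\<close>

lemma nn_integral_annulus_inverse_square:
  assumes "0 < a" "a < b"
  shows "(\<integral>\<^sup>+w\<in>{w. a < cmod w \<and> cmod w < b}. 1 / (cmod w)\<^sup>2 \<partial>lborel) = ennreal (2 * pi * ln (b / a))"
proof -
  define B where "B = box (Complex (ln a) (- pi)) (Complex (ln b) pi)"
  have memB: "z \<in> B \<longleftrightarrow> ln a < Re z \<and> Re z < ln b \<and> - pi < Im z \<and> Im z < pi" for z
    by (auto simp: B_def in_box_complex_iff)
  have inj: "inj_on exp B"
    by (rule inj_onI, rule exp_complex_eqI) (auto simp: memB)
  have im: "exp ` B = {w. a < cmod w \<and> cmod w < b \<and> w \<notin> \<real>\<^sub>\<le>\<^sub>0}"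
  proof safe
    fix w :: complex assume w: "a < cmod w" "cmod w < b" "w \<notin> \<real>\<^sub>\<le>\<^sub>0"
    then have "w \<noteq> 0" by auto
    with w have "Im (Ln w) \<noteq> pi" by (auto simp: Im_Ln_eq_pi complex_nonpos_Reals_iff)
    then have "\<bar>Im (Ln w)\<bar> < pi" using \<open>w \<noteq> 0\<close> mpi_less_Im_Ln[of w] Im_Ln_le_pi[of w] by linarith
    then have "Ln w \<in> B" using w assms \<open>w \<noteq> 0\<close> unfolding memB by auto
    then show "w \<in> exp ` B" using \<open>w \<noteq> 0\<close> by (metis exp_Ln imageI)
  next
    fix z assume z: "z \<in> B" "exp z \<in> \<real>\<^sub>\<le>\<^sub>0"
    then have "exp z \<noteq> 0" "Re (exp z) < 0" "Im (exp z) = 0"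
      using exp_not_eq_zero[of z] unfolding complex_nonpos_Reals_iff complex_eq_iff by auto
    then have "Im (Ln (exp z)) = pi" by (metis Im_Ln_eq_pi)
    moreover have "Ln (exp z) = z" using z by (intro Ln_exp) (auto simp: memB)
    ultimately show False using z by (auto simp: memB)
  next
    fix z assume "z \<in> B"
    then have "exp (ln a) < exp (Re z)" "exp (Re z) < exp (ln b)" by (simp_all add: memB)
    then show "a < cmod (exp z)" "cmod (exp z) < b"
      using assms by (simp_all add: norm_exp_eq_Re)
  qed
  \<comment> \<open>The slit lies on the real axis, a null set, so removing it does not change the
    integral.\<close>
  have "negligible {w. \<i> \<bullet> w = 0}" by (intro negligible_hyperplane) simp
  moreover have "{w. \<i> \<bullet> w = 0} = {w. Im w = 0}" by auto
  moreover have "closed {w. Im w = 0}" by (intro closed_Collect_eq continuous_intros)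
  ultimately have N: "{w. Im w = 0} \<in> null_sets lborel"
    by (simp add: negligible_iff_null_sets null_sets_completion_iff)
  have "(\<integral>\<^sup>+w\<in>{w. a < cmod w \<and> cmod w < b}. 1 / (cmod w)\<^sup>2 \<partial>lborel)
      = (\<integral>\<^sup>+w\<in>exp ` B. 1 / (cmod w)\<^sup>2 \<partial>lborel)"
    by (rule nn_integral_cong_AE, rule AE_I'[OF N])
       (auto simp: indicator_def im complex_nonpos_Reals_iff)
  also have "\<dots> = (\<integral>\<^sup>+z\<in>B. (cmod (deriv exp z))\<^sup>2 * (1 / (cmod (exp z))\<^sup>2) \<partial>lborel)"
    by (rule nn_integral_holomorphic_change_of_variables[symmetric])
      (use inj in \<open>auto intro!: holomorphic_intros continuous_intros simp: B_def\<close>)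
  also have "\<dots> = (\<integral>\<^sup>+z. indicator B z \<partial>lborel)"
    by (intro nn_integral_cong) (simp add: DERIV_imp_deriv[OF DERIV_exp])
  also have "\<dots> = emeasure lborel B" by (simp add: B_def)
  also have "\<dots> = ennreal ((ln b - ln a) * (2 * pi))"
    unfolding B_def using assms by (subst emeasure_lborel_box) (auto simp: Basis_complex_def)
  finally show ?thesis using assms by (simp add: ln_div mult.commute)
qed

text \<open>The integral of \<open>|f'/f|^2\<close> over \<open>S\<close> is bounded above by the
  logarithmic area of the ring, since \<open>f\<close> is injective on \<open>S\<close>, and below
  by the crossings on vertical segments. With \<open>m = ln (\<beta> / \<alpha>)\<close> this reads
  \<open>2 * L * m^2 / (2 * pi) \<le> 2 * pi * m\<close>. The set \<open>U\<close> allows the poles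
  of a meromorphic map to be left out.\<close>

lemma strip_length_area:
  fixes f :: "complex \<Rightarrow> complex"
  assumes \<alpha>\<beta>: "0 < \<alpha>" "\<alpha> < \<beta>" and "0 < L" and "open U" and holo: "f holomorphic_on U"
    and S_def: "S = {z \<in> U. - L < Re z \<and> Re z < L \<and> 0 < Im z \<and> Im z < 2 * pi \<and> \<alpha> < cmod (f z) \<and> cmod (f z) < \<beta>}"
    and inj: "inj_on f S"
    and cross: "\<And>x. \<bar>x\<bar> < L \<Longrightarrow> \<exists>a b. 0 \<le> a \<and> a < b \<and> b \<le> 2 * pi \<and>
        (\<forall>t\<in>{a..b}. Complex x t \<in> U \<and> f (Complex x t) \<noteq> 0) \<and>
        {cmod (f (Complex x a)), cmod (f (Complex x b))} = {\<alpha>, \<beta>} \<and>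
        (\<forall>t\<in>{a<..<b}. \<alpha> < cmod (f (Complex x t)) \<and> cmod (f (Complex x t)) < \<beta>)"
  shows "L \<le> 2 * pi\<^sup>2 / ln (\<beta> / \<alpha>)"
proof -
  define m where "m = ln (\<beta> / \<alpha>)"
  have "0 < m" using \<alpha>\<beta> by (simp add: m_def)
  define k where "k = (\<lambda>z. (cmod (deriv f z))\<^sup>2 * (1 / (cmod (f z))\<^sup>2))"
  have contf: "continuous_on U f" using holo by (rule holomorphic_on_imp_continuous_on)
  have contd: "continuous_on U (deriv f)"
    using holo \<open>open U\<close> by (intro holomorphic_on_imp_continuous_on holomorphic_deriv)
  have "open S"
  proof -
    have "open (U \<inter> f -` {w. \<alpha> < cmod w \<and> cmod w < \<beta>})"
      by (intro continuous_open_preimage contf \<open>open U\<close> open_Collect_conj open_Collect_less continuous_intros)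
    moreover have "open {z. - L < Re z \<and> Re z < L \<and> 0 < Im z \<and> Im z < 2 * pi}"
      by (intro open_Collect_conj open_Collect_less continuous_intros)
    moreover have "S = (U \<inter> f -` {w. \<alpha> < cmod w \<and> cmod w < \<beta>}) \<inter>
        {z. - L < Re z \<and> Re z < L \<and> 0 < Im z \<and> Im z < 2 * pi}"
      by (auto simp: S_def)
    ultimately show ?thesis by (simp only: open_Int)
  qed
  have "S \<subseteq> U" by (auto simp: S_def)
  have nzS: "f z \<noteq> 0" if "z \<in> S" for z using that \<alpha>\<beta> by (auto simp: S_def)
  have contk: "continuous_on A k" if "A \<subseteq> U" "\<And>z. z \<in> A \<Longrightarrow> f z \<noteq> 0" for A
    unfolding k_def using that by (intro continuous_intros continuous_on_subset[OF contf]
      continuous_on_subset[OF contd]) auto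

  have "(\<integral>\<^sup>+z\<in>S. k z \<partial>lborel) = (\<integral>\<^sup>+w\<in>f ` S. 1 / (cmod w)\<^sup>2 \<partial>lborel)"
    unfolding k_def
  proof (rule nn_integral_holomorphic_change_of_variables[OF \<open>open S\<close> _ inj])
    show "f holomorphic_on S" using holo \<open>S \<subseteq> U\<close> by (rule holomorphic_on_subset)
    show "continuous_on (f ` S) (\<lambda>w. 1 / (cmod w)\<^sup>2)"
      using nzS by (auto intro!: continuous_intros)
  qed auto
  also have "\<dots> \<le> (\<integral>\<^sup>+w\<in>{w. \<alpha> < cmod w \<and> cmod w < \<beta>}. 1 / (cmod w)\<^sup>2 \<partial>lborel)"
    by (intro nn_integral_mono) (auto simp: S_def indicator_def)
  also have "\<dots> = ennreal (2 * pi * m)"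
    unfolding m_def using \<alpha>\<beta> by (rule nn_integral_annulus_inverse_square)
  finally have upper: "(\<integral>\<^sup>+z\<in>S. k z \<partial>lborel) \<le> ennreal (2 * pi * m)" .

  \<comment> \<open>Length estimate on one vertical line: the image crosses the ring, so
    \<open>ln (cmod f)\<close> changes by exactly \<open>m\<close> over a parameter interval of
    length at most \<open>2 * pi\<close>.\<close>
  have seg: "ennreal (m\<^sup>2 / (2 * pi)) \<le> (\<integral>\<^sup>+y. ennreal (k (Complex x y)) * indicator S (Complex x y) \<partial>lborel)"
    if x: "\<bar>x\<bar> < L" for x
  proof -
    obtain a b where ab: "0 \<le> a" "a < b" "b \<le> 2 * pi"
      and U: "\<And>t. t \<in> {a..b} \<Longrightarrow> Complex x t \<in> U" and nz: "\<And>t. t \<in> {a..b} \<Longrightarrow> f (Complex x t) \<noteq> 0"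
      and ends: "{cmod (f (Complex x a)), cmod (f (Complex x b))} = {\<alpha>, \<beta>}"
      and betw: "\<And>t. t \<in> {a<..<b} \<Longrightarrow> \<alpha> < cmod (f (Complex x t)) \<and> cmod (f (Complex x t)) < \<beta>"
      using cross[OF x] by blast
    define I where "I = integral {a..b} (\<lambda>t. k (Complex x t))"
    have contC: "continuous_on {a..b} (Complex x)"
      by (auto simp: Complex_eq intro!: continuous_intros)
    have vd: "((\<lambda>t. f (Complex x t)) has_vector_derivative deriv f (Complex x t) * \<i>) (at t within {a..b})"
      if "t \<in> {a..b}" for t
    proof -
      have "(Complex x has_vector_derivative \<i>) (at t within {a..b})"
        unfolding Complex_eq by (auto intro!: derivative_eq_intros)
      moreover have "(f has_field_derivative deriv f (Complex x t)) (at (Complex x t) within Complex x ` {a..b})"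
        using holomorphic_derivI[OF holo \<open>open U\<close> U[OF that]] .
      ultimately show ?thesis
        using field_vector_diff_chain_within[of "Complex x" \<i> t "{a..b}" f "deriv f (Complex x t)"]
        by (simp add: o_def mult.commute)
    qed
    \<comment> \<open>The choice \<open>K = pi / m\<close> is optimal for length
      \<open>2 * pi\<close> and constant \<open>|f'/f| = m / (2 * pi)\<close>; it makes the error
      term at most \<open>m / 2\<close>, leaving half of \<open>m\<close> for the integral.\<close>
    have "\<bar>ln (cmod (f (Complex x b))) - ln (cmod (f (Complex x a)))\<bar> \<le> pi / m * I + (b - a) / (4 * (pi / m))"
    proof -
      have "continuous_on {a..b} (\<lambda>t. deriv f (Complex x t) * \<i>)"
        using U by (intro continuous_intros continuous_on_compose2[OF contd contC]) auto
      from log_variation_le[OF _ _ vd this nz, of "pi / m"] ab \<open>0 < m\<close>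
      show ?thesis by (simp add: I_def k_def norm_mult)
    qed
    moreover have "\<bar>ln (cmod (f (Complex x b))) - ln (cmod (f (Complex x a)))\<bar> = m"
    proof -
      have "m = ln \<beta> - ln \<alpha>" using \<alpha>\<beta> by (simp add: m_def ln_div)
      then show ?thesis using ends \<open>0 < m\<close> by (auto simp: doubleton_eq_iff)
    qed
    moreover have "(b - a) / (4 * (pi / m)) \<le> m / 2"
      using mult_right_mono[of "b - a" "2 * pi" m] ab \<open>0 < m\<close> by (simp add: field_simps)
    ultimately have "m / 2 \<le> pi / m * I" by linarith
    then have "m\<^sup>2 / (2 * pi) \<le> I" using \<open>0 < m\<close> by (simp add: field_simps power2_eq_square)
    \<comment> \<open>The open interval is used because at its ends \<open>cmod (f _)\<close> equals
      \<alpha> or \<beta>, so these points are not in \<open>S\<close>.\<close>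
    also have "ennreal I = (\<integral>\<^sup>+t\<in>{a<..<b}. k (Complex x t) \<partial>lborel)"
    proof (rule nn_integral_has_integral_lebesgue'[symmetric])
      have "continuous_on {a..b} (\<lambda>t. k (Complex x t))"
        using U nz by (intro continuous_on_compose2[OF contk contC, of "Complex x ` {a..b}"]) auto
      then have "((\<lambda>t. k (Complex x t)) has_integral I) (cbox a b)"
        unfolding I_def using integrable_continuous_real by (auto intro: integrable_integral)
      then show "((\<lambda>t. k (Complex x t)) has_integral I) {a<..<b}"
        unfolding has_integral_open_interval[symmetric] by simp
    qed (simp add: k_def)
    also have "\<dots> \<le> (\<integral>\<^sup>+y. ennreal (k (Complex x y)) * indicator S (Complex x y) \<partial>lborel)"
      using betw x U ab
      by (intro nn_integral_mono) (auto simp: S_def indicator_def)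
    finally show ?thesis using ennreal_leI by simp
  qed

  have meas: "(\<lambda>z. ennreal (k z) * indicator S z) \<in> borel_measurable borel"
    by (intro borel_measurable_ennreal_indicator \<open>open S\<close> contk \<open>S \<subseteq> U\<close> nzS)
  \<comment> \<open>Integrating the bound for each line over \<open>x\<close>, which ranges over an
    interval of length \<open>2 * L\<close>, and applying Fubini.\<close>
  have "ennreal (m\<^sup>2 / (2 * pi)) * ennreal (2 * L) = (\<integral>\<^sup>+x\<in>{- L<..<L}. ennreal (m\<^sup>2 / (2 * pi)) \<partial>lborel)"
    using \<open>0 < L\<close> by (simp add: nn_integral_cmult_indicator)
  also have "\<dots> \<le> (\<integral>\<^sup>+x. \<integral>\<^sup>+y. ennreal (k (Complex x y)) * indicator S (Complex x y) \<partial>lborel \<partial>lborel)"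
    using seg by (intro nn_integral_mono) (auto simp: indicator_def abs_less_iff)
  also have "\<dots> = (\<integral>\<^sup>+z\<in>S. k z \<partial>lborel)"
    by (rule nn_integral_complex_eq_iterated[OF meas, symmetric])
  also note upper
  finally have "ennreal (m\<^sup>2 / (2 * pi) * (2 * L)) \<le> ennreal (2 * pi * m)"
    by (subst ennreal_mult') (use \<open>0 < L\<close> in auto)
  then have "m\<^sup>2 / (2 * pi) * (2 * L) \<le> 2 * pi * m"
    using \<open>0 < m\<close> by (subst (asm) ennreal_le_iff) auto
  then have "m * (m * L) \<le> m * (2 * pi\<^sup>2)" by (simp add: field_simps power2_eq_square)
  then have "m * L \<le> 2 * pi\<^sup>2" using \<open>0 < m\<close> by simp
  then show ?thesis unfolding m_def[symmetric] using \<open>0 < m\<close> by (simp add: field_simps)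
qed

subsection \<open>The Moebius map with zero \<open>-1/p\<close> and pole \<open>p\<close>\<close>

text \<open>The line \<open>Re w = (p - 1 / p) / 2\<close> is the perpendicular bisector of the
  segment from \<open>-1/p\<close> to \<open>p\<close>; points to its right are nearer to
  \<open>p\<close>.\<close>

lemma norm_diff_le_norm_add_inverse:
  assumes "p > 0" and "(p - 1 / p) / 2 \<le> Re w"
  shows "cmod (w - of_real p) \<le> cmod (w + of_real (1 / p))"
proof -
  have "0 \<le> (p + 1 / p) * (2 * Re w - (p - 1 / p))" using assms by simp
  also have "\<dots> = (cmod (w + of_real (1 / p)))\<^sup>2 - (cmod (w - of_real p))\<^sup>2"
    unfolding cmod_power2 by (simp add: algebra_simps power2_eq_square)
  finally show ?thesis by (simp add: power_mono_iff flip: abs_le_square_iff)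
qed

text \<open>The previous bound is applied to \<open>- 1 / w\<close>. The map
  \<open>w \<mapsto> - 1 / w\<close> exchanges \<open>p\<close> and \<open>-1/p\<close>, and
  multiplying by \<open>w\<close> clears the denominators at the cost of the factor
  \<open>p^2\<close>.\<close>

lemma norm_add_inverse_le_norm_diff:
  assumes "p > 0" and "w \<noteq> 0" and "(p - 1 / p) / 2 \<le> Re (- 1 / w)"
  shows "p\<^sup>2 * cmod (w + of_real (1 / p)) \<le> cmod (w - of_real p)"
proof -
  from norm_diff_le_norm_add_inverse[OF assms(1,3)]
  have "cmod (w * (- 1 / w - of_real p)) \<le> cmod (w * (- 1 / w + of_real (1 / p)))"
    unfolding norm_mult by (intro mult_left_mono) auto
  also have "w * (- 1 / w - of_real p) = - of_real p * (w + of_real (1 / p))"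
    using assms by (simp add: field_simps)
  also have "w * (- 1 / w + of_real (1 / p)) = of_real (1 / p) * (w - of_real p)"
    using assms by (simp add: field_simps)
  finally have "p * cmod (w + of_real (1 / p)) \<le> 1 / p * cmod (w - of_real p)"
    using assms(1) by (simp only: norm_mult norm_minus_cancel norm_of_real abs_of_pos zero_less_divide_1_iff)
  from mult_left_mono[OF this, of p] show ?thesis
    using assms(1) by (simp add: power2_eq_square mult.assoc)
qed

section \<open>Lifting to a strip and applying the length-area inequality\<close>

theorem theorem2:
  fixes R lam :: real and g :: "complex \<Rightarrow> complex"
  assumes "R > 1"
    and "g holomorphic_on sym_annulus R"
    and "inj_on g (sym_annulus R)"
    and "\<And>z. z \<in> sym_annulus R \<Longrightarrow> g z \<noteq> 0"
    and "lam > 0"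
    and "central_coeff g = complex_of_real lam"
    and "central_coeff (\<lambda>z. 1 / g z) = - complex_of_real lam"
  shows "ln R \<le> pi\<^sup>2 / ln (lam + sqrt (1 + lam\<^sup>2))"
proof -
  define p where "p = lam + sqrt (1 + lam\<^sup>2)"
  define L where "L = ln R"
  have "L > 0" using assms(1) by (simp add: L_def)
  have "1 \<le> sqrt (1 + lam\<^sup>2)" by simp
  then have "p > 1" using \<open>lam > 0\<close> unfolding p_def by linarith
  have "(p - lam)\<^sup>2 = 1 + lam\<^sup>2" by (simp add: p_def)
  then have lam: "lam = (p - 1 / p) / 2"
    using \<open>p > 1\<close> by (simp add: field_simps power2_eq_square)
  \<comment> \<open>The exponential map sends this strip onto the annulus, and each vertical segment
    of length \<open>2 * pi\<close> once around a circle.\<close>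
  define V where "V = {z. - L < Re z \<and> Re z < L}"
  have "R = exp L" "1 / R = exp (- L)" using \<open>R > 1\<close> by (simp_all add: L_def exp_minus divide_inverse)
  then have ann: "exp z \<in> sym_annulus R \<longleftrightarrow> z \<in> V" for z
    by (simp add: V_def sym_annulus_def norm_exp_eq_Re)
  have "open V" unfolding V_def by (intro open_Collect_conj open_Collect_less continuous_intros)
  define G where "G = (\<lambda>z. g (exp z))"
  have holG: "G holomorphic_on V"
    unfolding G_def using holomorphic_on_compose_gen[OF holomorphic_on_exp assms(2), of V] ann
    by (auto simp: o_def)
  define f where "f = (\<lambda>z. (G z + of_real (1 / p)) / (G z - of_real p))"
  \<comment> \<open>The poles of \<open>f\<close>, where division by zero would yield the value 0,
    are removed.\<close>
  define U where "U = V \<inter> G -` (- {of_real p})"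
  have "open U" unfolding U_def
    by (intro continuous_open_preimage \<open>open V\<close> holomorphic_on_imp_continuous_on holG) auto
  have holf: "f holomorphic_on U"
    unfolding f_def by (intro holomorphic_intros holomorphic_on_subset[OF holG]) (auto simp: U_def)
  define S where "S = {z \<in> U. - L < Re z \<and> Re z < L \<and> 0 < Im z \<and> Im z < 2 * pi \<and>
    1 / p\<^sup>2 < cmod (f z) \<and> cmod (f z) < 1}"
  \<comment> \<open>The ring between the radii \<open>1 / p^2\<close> and 1 has logarithmic width
    \<open>2 * ln p\<close>, which turns this into the claimed bound.\<close>
  have "L \<le> 2 * pi\<^sup>2 / ln (1 / (1 / p\<^sup>2))"
  proof (rule strip_length_area[OF _ _ \<open>L > 0\<close> \<open>open U\<close> holf S_def])
    show "inj_on f S"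
    proof (rule inj_onI)
      fix w z assume wz: "w \<in> S" "z \<in> S" "f w = f z"
      then have "G w \<noteq> of_real p" "G z \<noteq> of_real p" "w \<in> V" "z \<in> V" by (auto simp: S_def U_def)
      then have "(G w + of_real (1 / p)) * (G z - of_real p) = (G z + of_real (1 / p)) * (G w - of_real p)"
        using wz(3) unfolding f_def by (subst (asm) frac_eq_eq) auto
      \<comment> \<open>The factor is, up to sign, the determinant of the Moebius map; it is
        nonzero, so the map is injective.\<close>
      then have "(of_real p + of_real (1 / p)) * (G w - G z) = (0 :: complex)" by algebra
      moreover have "of_real p + of_real (1 / p) \<noteq> (0 :: complex)"
        using \<open>p > 1\<close> by (metis add_pos_pos less_irrefl less_trans of_real_add of_real_eq_0_iff
            zero_less_divide_1_iff zero_less_one)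
      ultimately have "G w = G z" by simp
      then have "exp w = exp z"
        using assms(3) ann \<open>w \<in> V\<close> \<open>z \<in> V\<close> by (auto simp: G_def inj_on_def)
      moreover have "\<bar>Im w - Im z\<bar> < 2 * pi"
      proof -
        have "0 < Im w" "Im w < 2 * pi" "0 < Im z" "Im z < 2 * pi"
          using wz(1,2) by (simp_all add: S_def)
        then show ?thesis by linarith
      qed
      ultimately show "w = z" by (metis exp_complex_eqI)
    qed
  next
    fix x assume x: "\<bar>x\<bar> < L"
    define r where "r = exp x"
    have r: "1 / R < r" "r < R"
      using ann[of "of_real x"] x unfolding sym_annulus_def V_def r_def
      by (auto simp: norm_exp_eq_Re)
    have V: "Complex x t \<in> V" for t using x by (auto simp: V_def)
    have Gr: "G (Complex x t) = g (of_real r * cis t)" for t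
      by (simp add: G_def r_def exp_eq_polar exp_of_real)
    have G0: "G (Complex x t) \<noteq> 0" for t
      using assms(4) ann V by (auto simp: G_def)
    define A where "A = (\<lambda>t. cmod (G (Complex x t) + of_real (1 / p)))"
    define B where "B = (\<lambda>t. cmod (G (Complex x t) - of_real p))"
    \<comment> \<open>With \<open>|f| = A / B\<close>, this is \<open>|f| / (1 + |f|)\<close> away
      from the poles and takes the value 1 at them, so it is continuous on the whole circle. The
      levels \<open>1 / p^2\<close> and 1 of \<open>|f|\<close> become \<open>1 / (1 + p^2)\<close>
      and \<open>1 / 2\<close>.\<close>
    define s where "s = (\<lambda>t. A t / (A t + B t))"
    have AB: "0 < A t + B t" "0 \<le> A t" "0 \<le> B t" for t
    proof -
      \<comment> \<open>The distance between \<open>p\<close> and \<open>-1/p\<close> bounds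
        \<open>A + B\<close> from below, so \<open>A\<close> and \<open>B\<close> never vanish
        together.\<close>
      have "0 < p + 1 / p" using \<open>p > 1\<close> by (simp add: add_pos_pos)
      also have "\<dots> = cmod (of_real (p + 1 / p))" using calculation by (simp only: norm_of_real)
      also have "\<dots> \<le> A t + B t"
        unfolding A_def B_def by (rule order_trans[OF _ norm_triangle_ineq4]) (simp add: add.commute)
      finally show "0 < A t + B t" .
    qed (auto simp: A_def B_def)
    have contG: "continuous_on {0..2 * pi} (\<lambda>t. G (Complex x t))"
      using V by (intro continuous_on_compose2[OF holomorphic_on_imp_continuous_on[OF holG]])
        (auto simp: Complex_eq intro!: continuous_intros)
    have p2: "1 < p\<^sup>2" using \<open>p > 1\<close> by (simp add: one_less_power)
    have "continuous_on {0..2 * pi} s"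
      unfolding s_def A_def B_def
      by (intro continuous_intros contG) (metis A_def B_def AB(1) less_irrefl)
    moreover have "1 / (1 + p\<^sup>2) < 1 / 2"
      using p2 by (intro divide_strict_left_mono) auto
    \<comment> \<open>The inner level is reached because \<open>- 1 / g\<close> also has mean
      \<open>lam\<close>.\<close>
    moreover obtain u where "u \<in> {0..2 * pi}" "s u \<le> 1 / (1 + p\<^sup>2)"
    proof -
      have "central_coeff (\<lambda>z. - 1 / g z) = of_real lam"
        using assms(7) central_coeff_minus[of "\<lambda>z. 1 / g z"] by simp
      moreover have "(\<lambda>z. - 1 / g z) holomorphic_on sym_annulus R"
        using assms(2,4) by (intro holomorphic_intros) auto
      ultimately obtain u where u: "u \<in> {0..2 * pi}" "lam \<le> Re (- 1 / G (Complex x u))"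
        using ex_Re_ge_central_coeff[OF \<open>R > 1\<close> _ r, of "\<lambda>z. - 1 / g z"] unfolding Gr by auto
      then have "p\<^sup>2 * A u \<le> B u"
        unfolding A_def B_def lam using \<open>p > 1\<close> G0 by (intro norm_add_inverse_le_norm_diff) auto
      then have "A u \<le> (A u + B u) / (1 + p\<^sup>2)"
        using p2 by (intro mult_imp_le_div_pos) (auto simp: algebra_simps)
      then have "s u \<le> 1 / (1 + p\<^sup>2)"
        unfolding s_def using AB(1)[of u] by (intro mult_imp_div_pos_le) auto
      with u that show thesis by blast
    qed
    moreover obtain v where "v \<in> {0..2 * pi}" "1 / 2 \<le> s v"
    proof -
      obtain v where v: "v \<in> {0..2 * pi}" "lam \<le> Re (G (Complex x v))"
        using ex_Re_ge_central_coeff[OF \<open>R > 1\<close> assms(2) r] assms(6) unfolding Gr by auto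
      then have "B v \<le> A v"
        unfolding A_def B_def lam using \<open>p > 1\<close> by (intro norm_diff_le_norm_add_inverse) auto
      then have "1 / 2 \<le> s v"
        using AB(1)[of v] by (simp add: s_def field_simps)
      with v that show thesis by blast
    qed
    ultimately obtain a b where ab: "0 \<le> a" "a < b" "b \<le> 2 * pi" and ends: "{s a, s b} = {1 / (1 + p\<^sup>2), 1 / 2}"
      and betw: "\<And>t. t \<in> {a<..<b} \<Longrightarrow> 1 / (1 + p\<^sup>2) < s t \<and> s t < 1 / 2"
      using continuous_crossing_interval[of 0 "2 * pi" s] by metis
    \<comment> \<open>On the closed crossing interval \<open>s\<close> stays away from 1, the value
      at a pole, and from 0, the value at a zero of \<open>f\<close>.\<close>
    have s_le: "1 / (1 + p\<^sup>2) \<le> s t \<and> s t \<le> 1 / 2" if "t \<in> {a..b}" for t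
      using that betw[of t] ends \<open>1 / (1 + p\<^sup>2) < 1 / 2\<close>
      by (cases "t = a \<or> t = b") (auto simp: doubleton_eq_iff)
    have f_eq: "cmod (f (Complex x t)) = s t / (1 - s t)" for t
    proof -
      have "1 - s t = B t / (A t + B t)"
        using AB(1)[of t] by (simp add: s_def diff_divide_eq_iff)
      then have "s t / (1 - s t) = A t / B t"
        using AB(1)[of t] by (simp add: s_def)
      then show ?thesis by (simp add: f_def norm_divide A_def B_def)
    qed
    have pos: "0 < 1 / (1 + p\<^sup>2)" by (simp add: add_pos_nonneg)
    show "\<exists>a b. 0 \<le> a \<and> a < b \<and> b \<le> 2 * pi \<and>
        (\<forall>t\<in>{a..b}. Complex x t \<in> U \<and> f (Complex x t) \<noteq> 0) \<and>
        {cmod (f (Complex x a)), cmod (f (Complex x b))} = {1 / p\<^sup>2, 1} \<and>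
        (\<forall>t\<in>{a<..<b}. 1 / p\<^sup>2 < cmod (f (Complex x t)) \<and> cmod (f (Complex x t)) < 1)"
    proof (rule exI[of _ a], rule exI[of _ b], intro conjI ballI ab)
      fix t assume t: "t \<in> {a..b}"
      have "s t < 1" using s_le[OF t] by simp
      then have "B t \<noteq> 0" using AB[of t] by (auto simp: s_def)
      then show "Complex x t \<in> U" using V by (auto simp: U_def B_def)
      have "0 < s t" using s_le[OF t] pos by linarith
      then have "0 < cmod (f (Complex x t))" using \<open>s t < 1\<close> by (simp add: f_eq)
      then show "f (Complex x t) \<noteq> 0" by simp
    next
      show "{cmod (f (Complex x a)), cmod (f (Complex x b))} = {1 / p\<^sup>2, 1}"
      proof -
        have "1 / (1 + p\<^sup>2) / (1 - 1 / (1 + p\<^sup>2)) = 1 / p\<^sup>2"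
          using p2 by (simp add: field_simps)
        then show ?thesis
          using ends \<open>1 / (1 + p\<^sup>2) < 1 / 2\<close> by (auto simp: doubleton_eq_iff f_eq)
      qed
    next
      fix t assume t: "t \<in> {a<..<b}"
      have "0 < p\<^sup>2" "0 < 1 + p\<^sup>2" using p2 by linarith+
      then show "1 / p\<^sup>2 < cmod (f (Complex x t))" "cmod (f (Complex x t)) < 1"
        using betw[OF t] by (simp_all add: f_eq field_simps)
    qed
  qed (use \<open>p > 1\<close> in auto)
  also have "ln (1 / (1 / p\<^sup>2)) = 2 * ln p" using \<open>p > 1\<close> by (simp add: ln_realpow)
  finally show ?thesis by (simp add: L_def p_def)
qed

end
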